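(* Let $n\ge5$ and $\alpha^\diamond:=n/(n+2)$. Then there exists a constant $\delta>1/4$ such that for every $C\in\mathbb{S}_C$ and $u^*\in\mathbb{S}_u$ satisfying $$\mathbb{D}_{\alpha^\diamond}(C,u^* )\le\frac{\delta n(n+2)}{n-1},$$ the instance $\mathcal{MC}(C,u^* )$ does not have any spurious second-order critical points.
   Context: $\mathbb{S}_C$: the set of symmetric matrices $C\in\mathbb{R}^{n\times n}$ with nonnegative entries and $\sum_{i,j}C_{ij}=1$. $\mathbb{S}_u$: the set of $u\in\mathbb{R}^n$ with $\|u\|_1=1$. For $C\in\mathbb{S}_C$, $u^*\in\mathbb{S}_u$, the instance $\mathcal{MC}(C,u^* )$ is the problem of minimizing $g(u;C,u^* )=\sum_{i,j\in[n]}C_{ij}(u_iu_j-u_i^*u_j^* )^2$ over $u\in\mathbb{R}^n$. A spurious second-order critical point is a point $u$ with $\nabla g(u;C,u^* )=0$, $\nabla^2g(u;C,u^* )\succeq0$ and $uu^T\ne u^*(u^* )^T$. Degenerate set: $\mathcal{D}:=\{(C,u^* ): C\in\mathbb{S}_C, u^*\in\mathbb{S}_u, \exists u\in\mathbb{R}^n \text{ with } g(u;C,u^* )=0,\ uu^T\ne u^*(u^* )^T\}$. Complexity metric: $\mathbb{D}_\alpha(C,u^* ):=\left[\inf_{(\tilde C,\tilde u^* )\in\mathcal{D}}\alpha\|C-\tilde C\|_1+(1-\alpha)\|u^*-\tilde u^*\|_1\right]^{-1}$ for $\alpha\in[0,1]$, with entrywise $\ell_1$-norms and the convention $1/0=+\infty$.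 *)

theory Defs
  imports "HOL-Analysis.Analysis"
begin

definition gradient :: "('a::euclidean_space \<Rightarrow> real) \<Rightarrow> 'a \<Rightarrow> 'a" where
  "gradient f x = (THE D. GDERIV f x :> D)"

lemma gradient_eqI:
  assumes "GDERIV f x :> D"
  shows "gradient f x = D"
  unfolding gradient_def
proof (rule the_equality)
  fix E assume "GDERIV f x :> E"
  then have "(\<lambda>h. h \<bullet> E) = (\<lambda>h. h \<bullet> D)"
    using assms unfolding gderiv_def by (rule has_derivative_unique)
  then have "\<forall>h. h \<bullet> E = h \<bullet> D"
    by metis
  then show "E = D"
    using vector_eq_ldot[of E D] by blast
qed (rule assms)

definition hessian :: "(real ^ 'n \<Rightarrow> real) \<Rightarrow> real ^ 'n \<Rightarrow> real ^ 'n ^ 'n" where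
  "hessian f x = jacobian (gradient f) (at x)"

definition positive_semidefinite :: "real ^ 'n ^ 'n \<Rightarrow> bool" where
  "positive_semidefinite A \<longleftrightarrow> transpose A = A \<and> (\<forall>v. v \<bullet> (A *v v) \<ge> 0)"

definition outer_product :: "real ^ 'n \<Rightarrow> real ^ 'n \<Rightarrow> real ^ 'n ^ 'n" where
  "outer_product u v = (\<chi> i j. u $ i * v $ j)"

definition vec_l1_norm :: "real ^ 'n \<Rightarrow> real" where
  "vec_l1_norm u = (\<Sum>i\<in>UNIV. \<bar>u $ i\<bar>)"

definition mat_l1_norm :: "real ^ 'n ^ 'm \<Rightarrow> real" where
  "mat_l1_norm A = (\<Sum>i\<in>UNIV. \<Sum>j\<in>UNIV. \<bar>A $ i $ j\<bar>)"

definition weight_matrices :: "(real ^ 'n ^ 'n) set" where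
  "weight_matrices =
     {C. transpose C = C \<and> (\<forall>i j. C $ i $ j \<ge> 0) \<and> (\<Sum>i\<in>UNIV. \<Sum>j\<in>UNIV. C $ i $ j) = 1}"

definition l1_unit_sphere :: "(real ^ 'n) set" where
  "l1_unit_sphere = {u. vec_l1_norm u = 1}"

definition mc_objective :: "real ^ 'n ^ 'n \<Rightarrow> real ^ 'n \<Rightarrow> real ^ 'n \<Rightarrow> real" where
  "mc_objective C ustar u =
     (\<Sum>i\<in>UNIV. \<Sum>j\<in>UNIV. C $ i $ j * (u $ i * u $ j - ustar $ i * ustar $ j)\<^sup>2)"

definition spurious_socp :: "real ^ 'n ^ 'n \<Rightarrow> real ^ 'n \<Rightarrow> real ^ 'n \<Rightarrow> bool" where
  "spurious_socp C ustar u \<longleftrightarrow>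
     gradient (mc_objective C ustar) u = 0 \<and>
     positive_semidefinite (hessian (mc_objective C ustar) u) \<and>
     outer_product u u \<noteq> outer_product ustar ustar"

definition degenerate_set :: "((real ^ 'n ^ 'n) \<times> (real ^ 'n)) set" where
  "degenerate_set =
     {(C, ustar). C \<in> weight_matrices \<and> ustar \<in> l1_unit_sphere \<and>
        (\<exists>u. mc_objective C ustar u = 0 \<and> outer_product u u \<noteq> outer_product ustar ustar)}"

(* Extended reals, since inverse (0 :: ereal) = \<infinity>; on the reals inverse 0 = 0, which would
   make degenerate instances the least complex ones. *)
definition complexity_metric :: "real \<Rightarrow> real ^ 'n ^ 'n \<Rightarrow> real ^ 'n \<Rightarrow> ereal" where
  "complexity_metric \<alpha> C ustar =
     inverse (INF (C', ustar') \<in> degenerate_set.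
       ereal (\<alpha> * mat_l1_norm (C - C') + (1 - \<alpha>) * vec_l1_norm (ustar - ustar')))"

end

theory Submission
  imports Defs
begin

text \<open>Three families of degenerate instances bound the distance of \<open>(C, u\<^sup>*)\<close> to \<open>\<D>\<close> from above:
  isolate a vertex \<open>k\<close> by deleting its off-diagonal weights; restrict \<open>u\<^sup>*\<close> to \<open>{k, l}\<close> and delete
  \<open>C\<^sub>k\<^sub>k\<close>, \<open>C\<^sub>l\<^sub>l\<close>, which makes the graph bipartite; restrict \<open>u\<^sup>*\<close> to \<open>{k, l}\<close> and delete \<open>C\<^sub>k\<^sub>l\<close>, which
  disconnects it. Averaging these bounds shows that the distance is at most \<open>4 (n - 1) / (n (n + 2))\<close>,
  and that any instance close to this value has all weights close to \<open>1 / n\<^sup>2\<close>. For such weights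
  the objective is a small perturbation of the squared Frobenius norm of \<open>u u\<^sup>T - u\<^sup>* (u\<^sup>*)\<^sup>T\<close>, and the
  second-order condition in the direction \<open>u \<mp> u\<^sup>*\<close> excludes spurious critical points.\<close>

lemma transpose_eq_iff_nth:
  fixes C :: "'a ^ 'n ^ 'n"
  shows "transpose C = C \<longleftrightarrow> (\<forall>i j. C $ i $ j = C $ j $ i)"
  by (auto simp: transpose_def vec_eq_iff)

lemma sum_sum_add_swap:
  fixes f :: "'n::finite \<Rightarrow> 'n \<Rightarrow> real"
  shows "(\<Sum>i\<in>UNIV. \<Sum>j\<in>UNIV. f i j + f j i) = 2 * (\<Sum>i\<in>UNIV. \<Sum>j\<in>UNIV. f i j)"
  using sum.swap[of "\<lambda>i j. f j i" UNIV UNIV] by (simp add: sum.distrib)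

subsection \<open>First and second derivatives of the objective\<close>

text \<open>The factor 4 is the 2 from the square times the two positions of each variable in the
  double sum; the latter are merged by the symmetry of \<open>C\<close>.\<close>

definition mc_gradient :: "real ^ 'n ^ 'n \<Rightarrow> real ^ 'n \<Rightarrow> real ^ 'n \<Rightarrow> real ^ 'n" where
  "mc_gradient C z u =
     (\<chi> i. 4 * (\<Sum>j\<in>UNIV. C $ i $ j * (u $ i * u $ j - z $ i * z $ j) * u $ j))"

text \<open>Kept as a linear map in \<open>h\<close>, since the second-order condition is only
  tested in a single direction.\<close>

definition mc_second_derivative ::
    "real ^ 'n ^ 'n \<Rightarrow> real ^ 'n \<Rightarrow> real ^ 'n \<Rightarrow> real ^ 'n \<Rightarrow> real ^ 'n" where
  "mc_second_derivative C z u h =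
     (\<chi> i. 4 * (\<Sum>j\<in>UNIV. C $ i $ j *
        ((h $ i * u $ j + u $ i * h $ j) * u $ j + (u $ i * u $ j - z $ i * z $ j) * h $ j)))"

lemma has_derivative_vec_nth:
  "((\<lambda>x::real ^ 'n. x $ i) has_derivative (\<lambda>h. h $ i)) (at u)"
  by (rule bounded_linear.has_derivative[OF bounded_linear_vec_nth has_derivative_ident])

lemma has_derivative_vec_lambda:
  fixes f :: "'a::real_normed_vector \<Rightarrow> 'n::finite \<Rightarrow> real"
  assumes "\<And>i. ((\<lambda>x. f x i) has_derivative (\<lambda>h. f' h i)) (at u)"
  shows "((\<lambda>x. \<chi> i. f x i) has_derivative (\<lambda>h. \<chi> i. f' h i)) (at u)"
  using assms
  by (subst has_derivative_componentwise_within) (auto simp: Basis_vec_def inner_axis)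

lemma gderiv_mc_objective:
  assumes "transpose C = C"
  shows "GDERIV (mc_objective C z) u :> mc_gradient C z u"
proof -
  let ?e = "\<lambda>i j. u $ i * u $ j - z $ i * z $ j"
  have "(mc_objective C z has_derivative
      (\<lambda>h. \<Sum>i\<in>UNIV. \<Sum>j\<in>UNIV. C $ i $ j * (2 * ?e i j * (u $ i * h $ j + h $ i * u $ j)))) (at u)"
    unfolding mc_objective_def[abs_def]
    by (auto intro!: derivative_eq_intros has_derivative_vec_nth simp: algebra_simps)
  moreover have "(\<Sum>i\<in>UNIV. \<Sum>j\<in>UNIV. C $ i $ j * (2 * ?e i j * (u $ i * h $ j + h $ i * u $ j)))
      = h \<bullet> mc_gradient C z u" for h
  proof -
    let ?f = "\<lambda>i j. C $ i $ j * (2 * ?e i j * (h $ i * u $ j))"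
    have "(\<Sum>i\<in>UNIV. \<Sum>j\<in>UNIV. C $ i $ j * (2 * ?e i j * (u $ i * h $ j + h $ i * u $ j)))
        = (\<Sum>i\<in>UNIV. \<Sum>j\<in>UNIV. ?f i j + ?f j i)"
    proof (intro sum.cong refl)
      fix i j
      have "C $ j $ i = C $ i $ j"
        using assms by (simp add: transpose_eq_iff_nth)
      then show "C $ i $ j * (2 * ?e i j * (u $ i * h $ j + h $ i * u $ j)) = ?f i j + ?f j i"
        by (simp add: algebra_simps)
    qed
    also have "\<dots> = h \<bullet> mc_gradient C z u"
      unfolding sum_sum_add_swap
      by (simp add: inner_vec_def mc_gradient_def sum_distrib_left algebra_simps)
    finally show ?thesis .
  qed
  ultimately show ?thesis
    by (simp add: gderiv_def)
qed

lemma has_derivative_mc_gradient: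
  "(mc_gradient C z has_derivative mc_second_derivative C z u) (at u)"
  unfolding mc_gradient_def[abs_def] mc_second_derivative_def[abs_def]
  by (rule has_derivative_vec_lambda)
    (auto intro!: derivative_eq_intros has_derivative_vec_nth sum.cong
      simp: sum_distrib_left algebra_simps)

lemma gradient_mc_objective:
  assumes "transpose C = C"
  shows "gradient (mc_objective C z) = mc_gradient C z"
  using gderiv_mc_objective[OF assms] gradient_eqI by blast

lemma hessian_mc_objective_apply:
  assumes "transpose C = C"
  shows "hessian (mc_objective C z) u *v h = mc_second_derivative C z u h"
proof -
  let ?J = "jacobian (mc_gradient C z) (at u)"
  have "mc_gradient C z differentiable (at u)"
    using has_derivative_mc_gradient by (auto simp: differentiable_def)
  then have "(mc_gradient C z has_derivative (\<lambda>h. ?J *v h)) (at u)"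
    by (simp add: jacobian_works)
  from has_derivative_unique[OF this has_derivative_mc_gradient] show ?thesis
    by (simp add: hessian_def gradient_mc_objective[OF assms] fun_eq_iff)
qed

subsection \<open>Nearly uniform weights admit no spurious critical points\<close>

text \<open>With \<open>v = u - z\<close>, the error \<open>u u\<^sup>T - z z\<^sup>T\<close> equals \<open>u v\<^sup>T + v u\<^sup>T - v v\<^sup>T\<close>; the inequality
  is the second-order condition in direction \<open>v\<close> minus a multiple of the first-order one.\<close>
lemma socp_error_bound:
  assumes sym: "transpose C = C"
    and grad: "gradient (mc_objective C z) u = 0"
    and psd: "positive_semidefinite (hessian (mc_objective C z) u)"
  shows "3 * (\<Sum>i\<in>UNIV. \<Sum>j\<in>UNIV. C $ i $ j * (u $ i * u $ j - z $ i * z $ j)\<^sup>2)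
    \<le> (\<Sum>i\<in>UNIV. \<Sum>j\<in>UNIV. C $ i $ j * ((u $ i - z $ i) * (u $ j - z $ j))\<^sup>2)"
proof -
  define v where "v = u - z"
  define e where "e i j = u $ i * u $ j - z $ i * z $ j" for i j
  define G where "G i j = C $ i $ j * e i j * v $ i * u $ j" for i j
  define F where "F i j = C $ i $ j * ((v $ i * u $ j + u $ i * v $ j) * u $ j + e i j * v $ j) * v $ i"
    for i j
  have "v \<bullet> mc_gradient C z u = 4 * (\<Sum>i\<in>UNIV. \<Sum>j\<in>UNIV. G i j)"
    by (simp add: inner_vec_def mc_gradient_def G_def e_def sum_distrib_left mult_ac)
  then have G: "(\<Sum>i\<in>UNIV. \<Sum>j\<in>UNIV. G i j) = 0"
    using grad gradient_mc_objective[OF sym] by simp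
  have "0 \<le> v \<bullet> mc_second_derivative C z u v"
    using psd hessian_mc_objective_apply[OF sym] by (auto simp: positive_semidefinite_def)
  also have "v \<bullet> mc_second_derivative C z u v = 4 * (\<Sum>i\<in>UNIV. \<Sum>j\<in>UNIV. F i j)"
    by (simp add: inner_vec_def mc_second_derivative_def F_def e_def sum_distrib_left mult_ac)
  finally have F: "0 \<le> (\<Sum>i\<in>UNIV. \<Sum>j\<in>UNIV. F i j)"
    by simp
  \<comment> \<open>Entrywise identity after symmetrizing in \<open>i\<close>, \<open>j\<close>:
    with p = v_i v_j and s = v_i u_j + u_i v_j one has s = e + p, and s^2 + 2 e p - 4 e s = p^2 - 3
    e^2.\<close>
  have "(\<Sum>i\<in>UNIV. \<Sum>j\<in>UNIV. C $ i $ j * (v $ i * v $ j)\<^sup>2)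
      - 3 * (\<Sum>i\<in>UNIV. \<Sum>j\<in>UNIV. C $ i $ j * (e i j)\<^sup>2)
      = (\<Sum>i\<in>UNIV. \<Sum>j\<in>UNIV. (F i j + F j i) - 4 * (G i j + G j i))"
    unfolding sum_distrib_left sum_subtractf[symmetric]
  proof (intro sum.cong refl)
    fix i j
    have [simp]: "C $ j $ i = C $ i $ j"
      using sym by (simp add: transpose_eq_iff_nth)
    have z: "z $ i = u $ i - v $ i" "z $ j = u $ j - v $ j"
      by (auto simp: v_def)
    show "C $ i $ j * (v $ i * v $ j)\<^sup>2 - 3 * (C $ i $ j * (e i j)\<^sup>2) =
        (F i j + F j i) - 4 * (G i j + G j i)"
      unfolding F_def G_def e_def z by (simp, algebra)
  qed
  also have "\<dots> = 2 * (\<Sum>i\<in>UNIV. \<Sum>j\<in>UNIV. F i j) - 4 * (2 * (\<Sum>i\<in>UNIV. \<Sum>j\<in>UNIV. G i j))"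
    unfolding sum_subtractf sum_distrib_left[symmetric] sum_sum_add_swap ..
  also have "\<dots> \<ge> 0"
    using F G by simp
  finally show ?thesis
    by (simp add: e_def v_def)
qed

text \<open>The right side minus the left side is 4 <u,z> |u - z|^2 + (|u|^2 - |z|^2)^2. Orthogonal
  vectors of equal length give equality, and z = -u shows why the sign of <u,z> matters.\<close>

lemma norm_diff_pow4_le:
  fixes u z :: "'a::real_inner"
  assumes "0 \<le> u \<bullet> z"
  shows "((u - z) \<bullet> (u - z))\<^sup>2 \<le> 2 * ((u \<bullet> u)\<^sup>2 + (z \<bullet> z)\<^sup>2 - 2 * (u \<bullet> z)\<^sup>2)"
proof -
  have "0 \<le> (u - z) \<bullet> (u - z)"
    by simp
  then have "0 \<le> u \<bullet> u + z \<bullet> z - 2 * (u \<bullet> z)"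
    by (simp add: algebra_simps inner_commute)
  then have "0 \<le> 4 * (u \<bullet> z) * (u \<bullet> u + z \<bullet> z - 2 * (u \<bullet> z)) + (u \<bullet> u - z \<bullet> z)\<^sup>2"
    using assms by simp
  also have "\<dots> = 2 * ((u \<bullet> u)\<^sup>2 + (z \<bullet> z)\<^sup>2 - 2 * (u \<bullet> z)\<^sup>2) - ((u - z) \<bullet> (u - z))\<^sup>2"
    by (simp add: inner_diff_left inner_diff_right inner_commute[of z u] power2_eq_square algebra_simps)
  finally show ?thesis
    by simp
qed

lemma sum_sum_mult_squares:
  fixes a b :: "real ^ 'n"
  shows "(\<Sum>i\<in>UNIV. \<Sum>j\<in>UNIV. (a $ i * b $ i) * (a $ j * b $ j)) = (a \<bullet> b)\<^sup>2"
  by (simp add: inner_vec_def power2_eq_square sum_product)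

text \<open>Both double sums are squared Frobenius norms, of v v^T with v = u - z and of u u^T - z
  z^T, so this is \<open>norm_diff_pow4_le\<close> in coordinates.\<close>

lemma sum_sum_outer_diff_le:
  fixes u z :: "real ^ 'n"
  assumes "0 \<le> u \<bullet> z"
  shows "(\<Sum>i\<in>UNIV. \<Sum>j\<in>UNIV. ((u $ i - z $ i) * (u $ j - z $ j))\<^sup>2)
    \<le> 2 * (\<Sum>i\<in>UNIV. \<Sum>j\<in>UNIV. (u $ i * u $ j - z $ i * z $ j)\<^sup>2)"
proof -
  have "(\<Sum>i\<in>UNIV. \<Sum>j\<in>UNIV. (u $ i * u $ j - z $ i * z $ j)\<^sup>2)
    = (\<Sum>i\<in>UNIV. \<Sum>j\<in>UNIV. (u $ i * u $ i) * (u $ j * u $ j)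
        + (z $ i * z $ i) * (z $ j * z $ j) - ((u $ i * z $ i) * (u $ j * z $ j) + (u $ i * z $ i) * (u $ j * z $ j)))"
    by (intro sum.cong refl) (simp add: power2_eq_square algebra_simps)
  also have "\<dots> = (u \<bullet> u)\<^sup>2 + (z \<bullet> z)\<^sup>2 - 2 * (u \<bullet> z)\<^sup>2"
    by (simp only: sum_subtractf sum.distrib sum_sum_mult_squares)
  finally have E: "(\<Sum>i\<in>UNIV. \<Sum>j\<in>UNIV. (u $ i * u $ j - z $ i * z $ j)\<^sup>2)
    = (u \<bullet> u)\<^sup>2 + (z \<bullet> z)\<^sup>2 - 2 * (u \<bullet> z)\<^sup>2" .
  have "(\<Sum>i\<in>UNIV. \<Sum>j\<in>UNIV. ((u $ i - z $ i) * (u $ j - z $ j))\<^sup>2) = ((u - z) \<bullet> (u - z))\<^sup>2"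
    using sum_sum_mult_squares[of "u - z" "u - z"] by (simp add: power2_eq_square mult_ac)
  then show ?thesis
    using norm_diff_pow4_le[OF assms] unfolding E by simp
qed

text \<open>Replacing the weights by their bounds in \<open>socp_error_bound\<close> gives 3 L E
  \<le> U D \<le> 2 U E for the unweighted sums E and D. With 2 U < 3 L this forces E = 0, that is,
  u u^T = z z^T.\<close>

lemma no_spurious_socp_if_nearly_uniform:
  fixes C :: "real ^ 'n ^ 'n"
  assumes sym: "transpose C = C"
    and lo: "\<And>i j. L \<le> C $ i $ j" and up: "\<And>i j. C $ i $ j \<le> U"
    and LU: "2 * U < 3 * L"
  shows "\<not> spurious_socp C z u"
proof
  assume sp: "spurious_socp C z u"
  show False
  proof -
    \<comment> \<open>The objective sees \<open>z\<close> only through products of two entries, so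
      its sign may be chosen to make the inner product with \<open>u\<close> nonnegative.\<close>
    define z' where "z' = (if 0 \<le> u \<bullet> z then z else - z)"
    have zz: "z' $ i * z' $ j = z $ i * z $ j" for i j
      by (simp add: z'_def)
    have inner: "0 \<le> u \<bullet> z'"
      by (auto simp: z'_def)
    have "mc_objective C z' = mc_objective C z"
      unfolding mc_objective_def[abs_def] zz ..
    then have bound: "3 * (\<Sum>i\<in>UNIV. \<Sum>j\<in>UNIV. C $ i $ j * (u $ i * u $ j - z' $ i * z' $ j)\<^sup>2)
        \<le> (\<Sum>i\<in>UNIV. \<Sum>j\<in>UNIV. C $ i $ j * ((u $ i - z' $ i) * (u $ j - z' $ j))\<^sup>2)"
      using sp socp_error_bound[OF sym, of z' u] by (simp add: spurious_socp_def)
    let ?E = "\<Sum>i\<in>UNIV. \<Sum>j\<in>UNIV. (u $ i * u $ j - z' $ i * z' $ j)\<^sup>2"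
    let ?D = "\<Sum>i\<in>UNIV. \<Sum>j\<in>UNIV. ((u $ i - z' $ i) * (u $ j - z' $ j))\<^sup>2"
    have "outer_product u u \<noteq> outer_product z z"
      using sp by (simp add: spurious_socp_def)
    then obtain i j where ij: "u $ i * u $ j \<noteq> z' $ i * z' $ j"
      by (auto simp: outer_product_def vec_eq_iff zz)
    have "0 < (u $ i * u $ j - z' $ i * z' $ j)\<^sup>2"
      using ij by simp
    also have "\<dots> \<le> (\<Sum>j\<in>UNIV. (u $ i * u $ j - z' $ i * z' $ j)\<^sup>2)"
      by (rule member_le_sum) auto
    also have "\<dots> \<le> ?E"
      by (rule member_le_sum[where f = "\<lambda>i. \<Sum>j\<in>UNIV. (u $ i * u $ j - z' $ i * z' $ j)\<^sup>2"])
        (auto intro: sum_nonneg)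
    finally have E: "0 < ?E" .
    have "3 * (L * ?E) \<le> 3 * (\<Sum>i\<in>UNIV. \<Sum>j\<in>UNIV. C $ i $ j * (u $ i * u $ j - z' $ i * z' $ j)\<^sup>2)"
      unfolding sum_distrib_left by (intro sum_mono) (simp add: lo mult_right_mono)
    also note bound
    also have "(\<Sum>i\<in>UNIV. \<Sum>j\<in>UNIV. C $ i $ j * ((u $ i - z' $ i) * (u $ j - z' $ j))\<^sup>2) \<le> U * ?D"
      unfolding sum_distrib_left by (intro sum_mono) (simp add: up mult_right_mono)
    finally have le: "3 * (L * ?E) \<le> U * ?D" .
    have D: "0 \<le> ?D" "?D \<le> 2 * ?E"
      using sum_sum_outer_diff_le[OF inner] by (auto intro!: sum_nonneg)
    \<comment> \<open>The absolute value avoids a case split on the sign of \<open>U\<close>; in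
      fact \<open>L \<le> U\<close> and \<open>2 * U < 3 * L\<close> force \<open>U\<close> to be
      positive.\<close>
    have "U * ?D \<le> \<bar>U\<bar> * (2 * ?E)"
      using D by (intro mult_mono) auto
    moreover have "L \<le> U"
      using lo up order_trans by blast
    then have "2 * \<bar>U\<bar> < 3 * L"
      using LU by linarith
    then have "(2 * \<bar>U\<bar>) * ?E < (3 * L) * ?E"
      using E by (rule mult_strict_right_mono)
    ultimately show False
      using le by (simp add: mult_ac)
  qed
qed

subsection \<open>Upper bounds on the distance to the degenerate set\<close>

text \<open>Inverts the bound on the reciprocal of the infimum. Inversion is sound because the
  infimum is nonnegative; a zero infimum has inverse \<infinity> and is excluded by the
  hypothesis.\<close>

lemma complexity_metric_leD:
  assumes "complexity_metric \<alpha> C z \<le> ereal X" and "0 < X" and "0 \<le> \<alpha>" "\<alpha> \<le> 1"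
    and "(C', z') \<in> degenerate_set"
  shows "1 / X \<le> \<alpha> * mat_l1_norm (C - C') + (1 - \<alpha>) * vec_l1_norm (z - z')"
proof -
  let ?cost = "\<lambda>(C', z'). ereal (\<alpha> * mat_l1_norm (C - C') + (1 - \<alpha>) * vec_l1_norm (z - z'))"
  define I where "I = (INF x \<in> degenerate_set. ?cost x)"
  have "0 \<le> I"
    unfolding I_def using assms(3,4)
    by (auto intro!: INF_greatest add_nonneg_nonneg mult_nonneg_nonneg
        simp: mat_l1_norm_def vec_l1_norm_def sum_nonneg)
  moreover have "inverse I \<le> ereal X"
    using assms(1) by (simp add: complexity_metric_def I_def)
  ultimately have "ereal (1 / X) \<le> I"
    using \<open>0 < X\<close> by (cases I) (auto simp: field_simps split: if_splits)
  also have "I \<le> ?cost (C', z')"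
    unfolding I_def by (rule INF_lower[OF assms(5)])
  finally show ?thesis
    by simp
qed

section \<open>Approximation by ground truths and weight matrices with prescribed zeros\<close>

text \<open>Moving the mass outside \<open>S\<close> evenly onto \<open>S\<close> costs twice that
  mass. Mixing in a little of the uniform distribution on \<open>S\<close> makes every entry on
  \<open>S\<close> nonzero, at the extra cost \<open>\<eta>\<close>.\<close>

lemma l1_sphere_approx_support:
  fixes z :: "real ^ 'n"
  assumes z: "z \<in> l1_unit_sphere" and S: "S \<noteq> {}" and "0 < \<eta>"
  shows "\<exists>v \<in> l1_unit_sphere. (\<forall>i. v $ i \<noteq> 0 \<longleftrightarrow> i \<in> S) \<and>
    vec_l1_norm (z - v) \<le> 2 * (1 - (\<Sum>i\<in>S. \<bar>z $ i\<bar>)) + \<eta>"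
proof -
  define s where "s = min (1 / 2) (\<eta> / 2)"
  have s: "0 < s" "s < 1" "2 * s \<le> \<eta>"
    using \<open>0 < \<eta>\<close> by (auto simp: s_def)
  define m where "m = 1 - (\<Sum>i\<in>S. \<bar>z $ i\<bar>)"
  define K where "K = real (card S)"
  have K: "0 < K"
    using S by (simp add: K_def card_gt_0_iff)
  have one: "(\<Sum>i\<in>S. \<bar>z $ i\<bar>) + (\<Sum>i\<in>-S. \<bar>z $ i\<bar>) = 1"
    using z sum.Int_Diff[of UNIV "\<lambda>i. \<bar>z $ i\<bar>" S]
    by (simp add: l1_unit_sphere_def vec_l1_norm_def Compl_eq_Diff_UNIV)
  then have m: "(\<Sum>i\<in>-S. \<bar>z $ i\<bar>) = m"
    by (simp add: m_def)
  have "0 \<le> m"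
    unfolding m[symmetric] by (simp add: sum_nonneg)
  define p where "p i = (1 - s) * (\<bar>z $ i\<bar> + m / K) + s / K" for i
  have p: "0 < p i" for i
    using s K \<open>0 \<le> m\<close> by (auto simp: p_def intro!: add_nonneg_pos mult_nonneg_nonneg)
  \<comment> \<open>The signs of \<open>z\<close> are kept, so that on \<open>S\<close> the distance
    reduces to a distance of absolute values.\<close>
  define v :: "real ^ 'n" where
    "v = (\<chi> i. if i \<in> S then (if z $ i < 0 then - p i else p i) else 0)"
  have abs_v: "\<bar>v $ i\<bar> = (if i \<in> S then p i else 0)" for i
    using p[of i] by (auto simp: v_def)
  have dist: "\<bar>z $ i - v $ i\<bar> = \<bar>\<bar>z $ i\<bar> - p i\<bar>" if "i \<in> S" for i
    using that p[of i] by (auto simp: v_def)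
  have split: "(\<Sum>i\<in>UNIV. f i) = (\<Sum>i\<in>S. f i) + (\<Sum>i\<in>-S. f i)" for f :: "'n \<Rightarrow> real"
    using sum.Int_Diff[of UNIV f S] by (simp add: Compl_eq_Diff_UNIV)
  have "(\<Sum>i\<in>S. p i) = (1 - s) * ((\<Sum>i\<in>S. \<bar>z $ i\<bar>) + m) + s"
    using K unfolding p_def sum.distrib sum_distrib_left[symmetric] sum_constant K_def[symmetric]
    by simp
  also have "\<dots> = 1"
    by (simp add: m_def)
  finally have "v \<in> l1_unit_sphere"
    by (simp add: l1_unit_sphere_def vec_l1_norm_def abs_v sum.If_cases)
  moreover have "v $ i \<noteq> 0 \<longleftrightarrow> i \<in> S" for i
    using p[of i] by (auto simp: v_def)
  moreover have "vec_l1_norm (z - v) \<le> 2 * m + \<eta>"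
  proof -
    have "(\<Sum>i\<in>S. \<bar>z $ i - v $ i\<bar>) \<le> (\<Sum>i\<in>S. m / K + s * (\<bar>z $ i\<bar> + m / K + 1 / K))"
    proof (rule sum_mono)
      fix i assume "i \<in> S"
      have "0 \<le> m / K" "0 \<le> s * \<bar>z $ i\<bar>" "0 \<le> s * (m / K)" "0 \<le> s * (1 / K)"
        using s K \<open>0 \<le> m\<close> by auto
      moreover have "\<bar>z $ i\<bar> - p i = s * \<bar>z $ i\<bar> + s * (m / K) - m / K - s * (1 / K)"
        by (simp add: p_def algebra_simps diff_divide_distrib)
      ultimately show "\<bar>z $ i - v $ i\<bar> \<le> m / K + s * (\<bar>z $ i\<bar> + m / K + 1 / K)"
        unfolding dist[OF \<open>i \<in> S\<close>] distrib_left by linarith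
    qed
    also have "\<dots> = m + s * ((\<Sum>i\<in>S. \<bar>z $ i\<bar>) + m + 1)"
      using K unfolding sum.distrib sum_distrib_left[symmetric] sum_constant K_def[symmetric]
      by simp
    also have "\<dots> = m + 2 * s"
      by (simp add: m_def)
    finally have "(\<Sum>i\<in>S. \<bar>z $ i - v $ i\<bar>) \<le> m + 2 * s" .
    moreover have "(\<Sum>i\<in>-S. \<bar>z $ i - v $ i\<bar>) = m"
      unfolding m[symmetric] by (intro sum.cong) (auto simp: v_def)
    ultimately show ?thesis
      using s by (simp add: vec_l1_norm_def split)
  qed
  ultimately show ?thesis
    by (auto simp: m_def)
qed

lemma sum_sum_delta:
  fixes x :: real and a :: "'m::finite" and b :: "'n::finite"
  shows "(\<Sum>i\<in>UNIV. \<Sum>j\<in>UNIV. if i = a \<and> j = b then x else 0) = x"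
proof -
  have "(\<Sum>j\<in>UNIV. if i = a \<and> j = b then x else 0) = (if i = a then x else 0)" for i
    by (cases "i = a") auto
  then show ?thesis
    by simp
qed

text \<open>The deleted mass is put back, half each, at the unaffected positions (a, b) and (b, a).
  Deletion and insertion each cost that mass, whence the factor 2.\<close>

lemma weight_matrix_approx_zeros:
  fixes C :: "real ^ 'n ^ 'n"
  assumes C: "C \<in> weight_matrices"
    and P: "\<And>i j. P i j \<Longrightarrow> P j i" and ab: "\<not> P a b"
  shows "\<exists>C' \<in> weight_matrices. (\<forall>i j. P i j \<longrightarrow> C' $ i $ j = 0) \<and>
    mat_l1_norm (C - C') \<le> 2 * (\<Sum>i\<in>UNIV. \<Sum>j\<in>UNIV. if P i j then C $ i $ j else 0)"
proof -
  define M where "M = (\<Sum>i\<in>UNIV. \<Sum>j\<in>UNIV. if P i j then C $ i $ j else 0)"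
  \<comment> \<open>A sum of two conditionals rather than a disjunction: for \<open>a = b\<close>
    both halves land on the same diagonal entry.\<close>
  define D where "D i j = (if i = a \<and> j = b then M / 2 else 0) + (if i = b \<and> j = a then M / 2 else 0)"
    for i j
  have nonneg: "0 \<le> C $ i $ j" and sym: "C $ i $ j = C $ j $ i" for i j
    using C by (auto simp: weight_matrices_def transpose_def vec_eq_iff)
  have "0 \<le> M"
    using nonneg by (auto simp: M_def intro!: sum_nonneg)
  then have D_nonneg: "0 \<le> D i j" for i j
    unfolding D_def by (intro add_nonneg_nonneg) auto
  have D_sym: "D i j = D j i" for i j
    unfolding D_def by (subst add.commute) (simp only: conj_commute)
  have sum_D: "(\<Sum>i\<in>UNIV. \<Sum>j\<in>UNIV. D i j) = M"
    by (simp add: D_def sum.distrib sum_sum_delta)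
  define C' :: "real ^ 'n ^ 'n" where "C' = (\<chi> i j. (if P i j then 0 else C $ i $ j) + D i j)"
  have C'_nth: "C' $ i $ j = C $ i $ j - (if P i j then C $ i $ j else 0) + D i j" for i j
    by (simp add: C'_def)
  have "(\<Sum>i\<in>UNIV. \<Sum>j\<in>UNIV. C' $ i $ j) = 1"
    using C by (simp add: C'_nth sum.distrib sum_subtractf sum_D weight_matrices_def flip: M_def)
  moreover have "C' $ i $ j = C' $ j $ i" "0 \<le> C' $ i $ j" for i j
    using P D_nonneg[of i j] D_sym[of i j] nonneg[of i j] sym[of i j]
    by (auto simp: C'_def)
  ultimately have "C' \<in> weight_matrices"
    by (auto simp: weight_matrices_def transpose_def vec_eq_iff)
  moreover have "C' $ i $ j = 0" if "P i j" for i j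
  proof -
    have "\<not> (i = a \<and> j = b)" "\<not> (i = b \<and> j = a)"
      using that ab P by blast+
    then have "D i j = 0"
      by (simp only: D_def if_False add_0)
    then show ?thesis
      using that by (simp add: C'_def)
  qed
  moreover have "mat_l1_norm (C - C') \<le> 2 * M"
  proof -
    have "mat_l1_norm (C - C') \<le> (\<Sum>i\<in>UNIV. \<Sum>j\<in>UNIV. (if P i j then C $ i $ j else 0) + D i j)"
      unfolding mat_l1_norm_def
    proof (intro sum_mono)
      fix i j
      show "\<bar>(C - C') $ i $ j\<bar> \<le> (if P i j then C $ i $ j else 0) + D i j"
        using nonneg[of i j] D_nonneg[of i j] by (auto simp: C'_nth)
    qed
    also have "\<dots> = 2 * M"
      by (simp add: sum.distrib sum_D flip: M_def)
    finally show ?thesis .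
  qed
  ultimately show ?thesis
    by (auto simp: M_def)
qed

text \<open>Deleting the weights at \<open>P\<close> and restricting the ground truth to the support \<open>S\<close> yields a
  degenerate instance. At the stated cost, support exactly \<open>S\<close> can only be approximated, whence the
  limit argument.\<close>
lemma degenerate_cost_le:
  fixes C :: "real ^ 'n ^ 'n"
  assumes C: "C \<in> weight_matrices" and z: "z \<in> l1_unit_sphere"
    and \<alpha>: "0 \<le> \<alpha>" "\<alpha> \<le> 1"
    and low: "\<And>C' z'. (C', z') \<in> degenerate_set \<Longrightarrow>
      c \<le> \<alpha> * mat_l1_norm (C - C') + (1 - \<alpha>) * vec_l1_norm (z - z')"
    and S: "S \<noteq> {}" and P: "\<And>i j. P i j \<Longrightarrow> P j i" and ab: "\<not> P a b"
    and alt: "\<And>v :: real ^ 'n. (\<And>i. v $ i \<noteq> 0 \<longleftrightarrow> i \<in> S) \<Longrightarrow>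
      \<exists>w. (\<forall>i j. \<not> P i j \<longrightarrow> w $ i * w $ j = v $ i * v $ j) \<and>
        outer_product w w \<noteq> outer_product v v"
  shows "c \<le> \<alpha> * (2 * (\<Sum>i\<in>UNIV. \<Sum>j\<in>UNIV. if P i j then C $ i $ j else 0)) +
    (1 - \<alpha>) * (2 * (1 - (\<Sum>i\<in>S. \<bar>z $ i\<bar>)))" (is "_ \<le> \<alpha> * ?m + (1 - \<alpha>) * ?d")
proof (rule field_le_epsilon)
  fix \<eta> :: real assume "0 < \<eta>"
  obtain C' where C': "C' \<in> weight_matrices" "\<And>i j. P i j \<Longrightarrow> C' $ i $ j = 0"
      "mat_l1_norm (C - C') \<le> ?m"
    using weight_matrix_approx_zeros[where P = P, OF C P ab] by auto
  obtain v where v: "v \<in> l1_unit_sphere" "\<And>i. v $ i \<noteq> 0 \<longleftrightarrow> i \<in> S"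
      "vec_l1_norm (z - v) \<le> ?d + \<eta>"
    using l1_sphere_approx_support[OF z S \<open>0 < \<eta>\<close>] by auto
  obtain w where w: "\<And>i j. \<not> P i j \<Longrightarrow> w $ i * w $ j = v $ i * v $ j"
      "outer_product w w \<noteq> outer_product v v"
    using alt v(2) by blast
  have "C' $ i $ j * (w $ i * w $ j - v $ i * v $ j)\<^sup>2 = 0" for i j
    using C'(2)[of i j] w(1)[of i j] by (cases "P i j") auto
  then have "mc_objective C' v w = 0"
    by (simp only: mc_objective_def sum.neutral_const)
  then have "(C', v) \<in> degenerate_set"
    using C'(1) v(1) w(2) by (auto simp: degenerate_set_def)
  then have "c \<le> \<alpha> * mat_l1_norm (C - C') + (1 - \<alpha>) * vec_l1_norm (z - v)"
    by (rule low)
  also have "\<dots> \<le> \<alpha> * ?m + (1 - \<alpha>) * (?d + \<eta>)"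
    using \<alpha> C'(3) v(3) by (intro add_mono mult_left_mono) auto
  also have "\<dots> \<le> \<alpha> * ?m + (1 - \<alpha>) * ?d + \<eta>"
    using \<alpha> \<open>0 < \<eta>\<close> by (simp add: algebra_simps)
  finally show "c \<le> \<alpha> * ?m + (1 - \<alpha>) * ?d + \<eta>" .
qed

lemma outer_product_neqI:
  assumes "w $ i * w $ j \<noteq> v $ i * v $ j"
  shows "outer_product w w \<noteq> outer_product v v"
  using assms by (auto simp: outer_product_def vec_eq_iff)

section \<open>The three families of degenerate instances\<close>

context
  fixes C :: "real ^ 'n ^ 'n" and z :: "real ^ 'n" and \<alpha> c :: real
  assumes C: "C \<in> weight_matrices" and z: "z \<in> l1_unit_sphere"
    and \<alpha>: "0 \<le> \<alpha>" "\<alpha> \<le> 1"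
    and low: "\<And>C' z'. (C', z') \<in> degenerate_set \<Longrightarrow>
      c \<le> \<alpha> * mat_l1_norm (C - C') + (1 - \<alpha>) * vec_l1_norm (z - z')"
begin

text \<open>Once \<open>k\<close> is isolated, flipping the sign of coordinate \<open>k\<close>
  changes no weighted product. The support is everything, so the ground truth contributes no cost.
  The factor 4 counts row and column \<open>k\<close>, and deletion and reinsertion at (k,
  k).\<close>

lemma degenerate_cost_isolate:
  assumes "2 \<le> CARD('n)"
  shows "c \<le> 4 * \<alpha> * (\<Sum>j\<in>-{k}. C $ k $ j)"
proof -
  let ?P = "\<lambda>i j. (i = k) \<noteq> (j = k)"
  have "card {k} < CARD('n)"
    using assms by simp
  then have "{k} \<noteq> (UNIV :: 'n set)"
    by (metis less_irrefl)
  then obtain l where l: "l \<noteq> k"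
    by blast
  have "c \<le> \<alpha> * (2 * (\<Sum>i\<in>UNIV. \<Sum>j\<in>UNIV. if ?P i j then C $ i $ j else 0)) +
      (1 - \<alpha>) * (2 * (1 - (\<Sum>i\<in>UNIV. \<bar>z $ i\<bar>)))"
  proof (rule degenerate_cost_le[where P = ?P and S = UNIV and a = k and b = k, OF C z \<alpha> low])
    fix v :: "real ^ 'n" assume v: "\<And>i. v $ i \<noteq> 0 \<longleftrightarrow> i \<in> UNIV"
    let ?w = "\<chi> i. if i = k then - v $ i else v $ i"
    have "outer_product ?w ?w \<noteq> outer_product v v"
      using v l by (intro outer_product_neqI[of _ k l]) auto
    then show "\<exists>w. (\<forall>i j. \<not> ?P i j \<longrightarrow> w $ i * w $ j = v $ i * v $ j) \<and>
        outer_product w w \<noteq> outer_product v v"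
      by (intro exI[of _ ?w]) auto
  qed auto
  also have "(\<Sum>i\<in>UNIV. \<bar>z $ i\<bar>) = 1"
    using z by (simp add: l1_unit_sphere_def vec_l1_norm_def)
  also have "(\<Sum>i\<in>UNIV. \<Sum>j\<in>UNIV. if ?P i j then C $ i $ j else 0) = 2 * (\<Sum>j\<in>-{k}. C $ k $ j)"
  proof -
    have sym: "C $ i $ j = C $ j $ i" for i j
      using C by (auto simp: weight_matrices_def transpose_def vec_eq_iff)
    have split: "(\<Sum>i\<in>UNIV. f i) = f k + (\<Sum>i\<in>-{k}. f i)" for f :: "'n \<Rightarrow> real"
      by (simp add: sum.remove[of _ k] Compl_eq_Diff_UNIV)
    show ?thesis
      by (simp add: split sym)
  qed
  finally show ?thesis
    by simp
qed

text \<open>On support {k, l} without the two loops only the product of entries \<open>k\<close> and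
  \<open>l\<close> is observed, and rescaling these entries by 2 and 1/2 preserves it.\<close>

lemma degenerate_cost_bipartite:
  assumes "k \<noteq> l"
  shows "c \<le> \<alpha> * (2 * (C $ k $ k + C $ l $ l)) + (1 - \<alpha>) * (2 * (1 - \<bar>z $ k\<bar> - \<bar>z $ l\<bar>))"
proof -
  let ?P = "\<lambda>i j. (i = k \<and> j = k) \<or> (i = l \<and> j = l)"
  have "c \<le> \<alpha> * (2 * (\<Sum>i\<in>UNIV. \<Sum>j\<in>UNIV. if ?P i j then C $ i $ j else 0)) +
      (1 - \<alpha>) * (2 * (1 - (\<Sum>i\<in>{k, l}. \<bar>z $ i\<bar>)))"
  proof (rule degenerate_cost_le[where P = ?P and S = "{k, l}" and a = k and b = l, OF C z \<alpha> low])
    fix v :: "real ^ 'n" assume v: "\<And>i. v $ i \<noteq> 0 \<longleftrightarrow> i \<in> {k, l}"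
    let ?w = "\<chi> i. if i = k then 2 * v $ i else v $ i / 2"
    have "outer_product ?w ?w \<noteq> outer_product v v"
      using v by (intro outer_product_neqI[of _ k k]) auto
    moreover have "?w $ i * ?w $ j = v $ i * v $ j" if "\<not> ?P i j" for i j
      using v[of i] v[of j] that by auto
    ultimately show "\<exists>w. (\<forall>i j. \<not> ?P i j \<longrightarrow> w $ i * w $ j = v $ i * v $ j) \<and>
        outer_product w w \<noteq> outer_product v v"
      by blast
  next
    show "\<not> ?P k l"
      using assms by auto
  qed auto
  also have "(\<Sum>i\<in>UNIV. \<Sum>j\<in>UNIV. if ?P i j then C $ i $ j else 0) =
      (\<Sum>i\<in>UNIV. \<Sum>j\<in>UNIV. (if i = k \<and> j = k then C $ k $ k else 0) +
        (if i = l \<and> j = l then C $ l $ l else 0))"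
    using assms by (intro sum.cong refl) auto
  also have "\<dots> = C $ k $ k + C $ l $ l"
    by (simp only: sum.distrib sum_sum_delta)
  finally show ?thesis
    using assms by (simp add: algebra_simps)
qed

text \<open>On support {k, l} without the edge between them only squares of entries are observed, so
  the relative sign of the two entries is lost.\<close>

lemma degenerate_cost_disconnect:
  assumes "k \<noteq> l"
  shows "c \<le> \<alpha> * (4 * C $ k $ l) + (1 - \<alpha>) * (2 * (1 - \<bar>z $ k\<bar> - \<bar>z $ l\<bar>))"
proof -
  let ?P = "\<lambda>i j. (i = k \<and> j = l) \<or> (i = l \<and> j = k)"
  have "c \<le> \<alpha> * (2 * (\<Sum>i\<in>UNIV. \<Sum>j\<in>UNIV. if ?P i j then C $ i $ j else 0)) +
      (1 - \<alpha>) * (2 * (1 - (\<Sum>i\<in>{k, l}. \<bar>z $ i\<bar>)))"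
  proof (rule degenerate_cost_le[where P = ?P and S = "{k, l}" and a = k and b = k, OF C z \<alpha> low])
    fix v :: "real ^ 'n" assume v: "\<And>i. v $ i \<noteq> 0 \<longleftrightarrow> i \<in> {k, l}"
    let ?w = "\<chi> i. if i = k then - v $ i else v $ i"
    have "outer_product ?w ?w \<noteq> outer_product v v"
      using v assms by (intro outer_product_neqI[of _ k l]) auto
    moreover have "?w $ i * ?w $ j = v $ i * v $ j" if "\<not> ?P i j" for i j
      using v[of i] v[of j] that by auto
    ultimately show "\<exists>w. (\<forall>i j. \<not> ?P i j \<longrightarrow> w $ i * w $ j = v $ i * v $ j) \<and>
        outer_product w w \<noteq> outer_product v v"
      by blast
  next
    show "\<not> ?P k k"
      using assms by auto
  qed auto
  also have "(\<Sum>i\<in>UNIV. \<Sum>j\<in>UNIV. if ?P i j then C $ i $ j else 0) =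
      (\<Sum>i\<in>UNIV. \<Sum>j\<in>UNIV. (if i = k \<and> j = l then C $ k $ l else 0) +
        (if i = l \<and> j = k then C $ l $ k else 0))"
    using assms by (intro sum.cong refl) auto
  also have "\<dots> = C $ k $ l + C $ l $ k"
    by (simp only: sum.distrib sum_sum_delta)
  also have "C $ l $ k = C $ k $ l"
    using C by (auto simp: weight_matrices_def transpose_def vec_eq_iff)
  finally show ?thesis
    using assms by (simp add: algebra_simps)
qed

end

subsection \<open>Rigidity\<close>

text \<open>Summing over all ordered pairs of distinct elements counts each \<open>w k\<close>
  exactly 2 (card A - 1) times.\<close>

lemma sum_nonneg_if_pairs_nonneg:
  fixes w :: "'a \<Rightarrow> real"
  assumes "finite A" "2 \<le> card A"
    and pair: "\<And>k l. k \<in> A \<Longrightarrow> l \<in> A \<Longrightarrow> k \<noteq> l \<Longrightarrow> 0 \<le> w k + w l"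
  shows "0 \<le> sum w A"
proof -
  let ?N = "real (card A)"
  have "0 \<le> (\<Sum>k\<in>A. \<Sum>l\<in>A - {k}. w k + w l)"
    using pair by (intro sum_nonneg) auto
  also have "\<dots> = (\<Sum>k\<in>A. (?N - 2) * w k + sum w A)"
  proof (rule sum.cong)
    fix k assume "k \<in> A"
    moreover from this have "real (card (A - {k})) = ?N - 1"
      using assms(1,2) by (simp add: of_nat_diff)
    ultimately show "(\<Sum>l\<in>A - {k}. w k + w l) = (?N - 2) * w k + sum w A"
      using assms(1) by (simp add: sum.distrib sum_diff1 algebra_simps)
  qed simp
  also have "\<dots> = (2 * (?N - 1)) * sum w A"
    by (simp only: sum.distrib sum_constant flip: sum_distrib_left) (simp add: algebra_simps)
  finally show ?thesis
    using assms(2) by (simp add: zero_le_mult_iff)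
qed

text \<open>The three hypotheses are the bounds by the distance to the degenerate set; for \<open>\<epsilon> = 0\<close>
  they force all weights to be equal.\<close>
lemma weights_nearly_uniform:
  fixes c :: "'n::finite \<Rightarrow> 'n \<Rightarrow> real" and a :: "'n \<Rightarrow> real"
  defines "N \<equiv> real CARD('n)"
  assumes N: "5 \<le> N" and eps: "0 \<le> \<epsilon>"
    and sum_c: "(\<Sum>i\<in>UNIV. \<Sum>j\<in>UNIV. c i j) = 1" and sum_a: "sum a UNIV = 1"
    and isolate: "\<And>k. 1 - 1 / N - \<epsilon> \<le> N * (\<Sum>j\<in>-{k}. c k j)"
    and bipartite: "\<And>k l. k \<noteq> l \<Longrightarrow> 1 - 1 / N - \<epsilon> \<le> 1 - a k - a l + N / 2 * (c k k + c l l)"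
    and disconnect: "\<And>k l. k \<noteq> l \<Longrightarrow> 1 - 1 / N - \<epsilon> \<le> 1 - a k - a l + N * c k l"
  shows "\<bar>c i j - 1 / N\<^sup>2\<bar> \<le> 6 * N\<^sup>2 * \<epsilon>"
proof -
  define q where "q = 1 / N"
  have Nq: "N * q = 1" and q: "0 < q" "q \<le> 1"
    using N by (auto simp: q_def)
  have Nqq: "N * q\<^sup>2 = q"
    using Nq by (simp add: power2_eq_square algebra_simps)
  have card_compl: "real (card (-{k :: 'n})) = N - 1" for k
    using N by (simp add: Compl_eq_Diff_UNIV card_Diff_subset N_def of_nat_diff)
  have split: "sum f UNIV = f k + sum f (-{k})" for f :: "'n \<Rightarrow> real" and k
    by (simp add: sum.remove[of _ k] Compl_eq_Diff_UNIV)
  define r where "r k = (\<Sum>j\<in>-{k}. c k j)" for k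
  define t where "t = (\<Sum>k\<in>UNIV. c k k)"
  have sum_r: "sum r UNIV = 1 - t"
    using sum_c split[of "c k" k for k] by (simp add: r_def t_def sum.distrib)
  have r_lower: "q * (1 - q - \<epsilon>) \<le> r k" for k
  proof -
    have "q * (1 - q - \<epsilon>) \<le> q * (N * r k)"
      using isolate[of k] q by (intro mult_left_mono) (auto simp: q_def r_def)
    then show ?thesis
      using Nq by (simp add: mult.assoc[symmetric] mult.commute)
  qed
  \<comment> \<open>The row bounds sum to a lower bound on the total off-diagonal mass, hence to an
    upper bound on the trace \<open>t\<close>.\<close>
  have t_upper: "t \<le> q + \<epsilon>"
  proof -
    have "(\<Sum>k\<in>(UNIV :: 'n set). q * (1 - q - \<epsilon>)) \<le> sum r UNIV"
      by (intro sum_mono r_lower)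
    then have "(N * q) * (1 - q - \<epsilon>) \<le> 1 - t"
      by (simp add: sum_r N_def)
    then show ?thesis
      by (simp add: Nq)
  qed

  \<comment> \<open>The slack in the bipartite bound for \<open>k\<close>, \<open>l\<close> splits
    as \<open>w k + w l\<close>, one share per vertex.\<close>
  define w where "w k = N / 2 * c k k - a k + (q + \<epsilon>) / 2" for k
  have w_pair: "0 \<le> w k + w l" if "k \<noteq> l" for k l
    using bipartite[OF that] by (simp add: w_def q_def algebra_simps)
  have "sum w UNIV = N / 2 * t - 1 + N * ((q + \<epsilon>) / 2)"
    by (simp add: w_def t_def sum.distrib sum_subtractf sum_a N_def sum_distrib_left)
  also have "\<dots> = N * t / 2 - (1 - N * \<epsilon>) / 2"
    using Nq by (simp add: algebra_simps) (simp add: field_simps)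
  finally have sum_w: "sum w UNIV = N * t / 2 - (1 - N * \<epsilon>) / 2" .
  have t_lower: "q - \<epsilon> \<le> t"
  proof -
    have "0 \<le> sum w UNIV"
      using N by (intro sum_nonneg_if_pairs_nonneg w_pair) (auto simp: N_def)
    then have "N * (q - \<epsilon>) \<le> N * t"
      using Nq by (simp add: sum_w algebra_simps)
    then show ?thesis
      using N by simp
  qed
  \<comment> \<open>The total of \<open>w\<close> is at most \<open>N * \<epsilon>\<close> by
    \<open>t_upper\<close>, and the at least three remaining vertices contribute a nonnegative
    sum.\<close>
  have w_upper: "w k + w l \<le> N * \<epsilon>" if "k \<noteq> l" for k l
  proof -
    have "card (-{k, l}) = CARD('n) - 2"
      using that by (simp add: Compl_eq_Diff_UNIV card_Diff_subset)
    then have "0 \<le> sum w (-{k, l})"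
      using N by (intro sum_nonneg_if_pairs_nonneg w_pair) (auto simp: N_def)
    moreover have "sum w UNIV = sum w {k, l} + sum w (-{k, l})"
      by (simp add: Compl_eq_Diff_UNIV sum.subset_diff[of "{k, l}" UNIV])
    moreover have "N * t \<le> N * (q + \<epsilon>)"
      using t_upper N by simp
    then have "N * t \<le> 1 + N * \<epsilon>"
      using Nq by (simp add: algebra_simps)
    ultimately show ?thesis
      using that by (simp add: sum_w field_simps)
  qed

  \<comment> \<open>Combining the disconnection bound with \<open>w_upper\<close> eliminates
    \<open>a\<close>.\<close>
  have off_diag: "(c k k + c l l) / 2 - \<epsilon> \<le> c k l" if "k \<noteq> l" for k l
  proof -
    have "N * ((c k k + c l l) / 2 - \<epsilon>) \<le> N * c k l"
      using disconnect[OF that] w_upper[OF that] by (simp add: w_def q_def algebra_simps)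
    then show ?thesis
      using N by simp
  qed
  have r_lower': "((N - 2) * c k k + t) / 2 - (N - 1) * \<epsilon> \<le> r k" for k
  proof -
    have "(\<Sum>l\<in>-{k}. (c k k / 2 - \<epsilon>) + c l l / 2) \<le> r k"
      unfolding r_def
    proof (rule sum_mono)
      fix l assume "l \<in> -{k}"
      then show "(c k k / 2 - \<epsilon>) + c l l / 2 \<le> c k l"
        using off_diag[of k l] by (simp add: add_divide_distrib)
    qed
    moreover have "(\<Sum>l\<in>-{k}. (c k k / 2 - \<epsilon>) + c l l / 2)
        = (N - 1) * (c k k / 2 - \<epsilon>) + (t - c k k) / 2"
      using split[of "\<lambda>l. c l l" k] card_compl[of k]
      by (simp add: sum.distrib t_def flip: sum_divide_distrib)
    ultimately show ?thesis
      by (simp add: field_simps)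
  qed
  \<comment> \<open>All other rows satisfy \<open>r_lower\<close>, and the rows together carry mass
    \<open>1 - t\<close>.\<close>
  have r_upper: "r k \<le> q * (1 - q) + 2 * \<epsilon>" for k
  proof -
    have "(\<Sum>j\<in>-{k}. q * (1 - q - \<epsilon>)) \<le> sum r (-{k})"
      by (intro sum_mono r_lower)
    then have "(N - 1) * (q * (1 - q - \<epsilon>)) \<le> 1 - t - r k"
      using split[of r k] card_compl[of k] by (simp add: sum_r)
    moreover have "(N - 1) * (q * (1 - q - \<epsilon>)) = (N * q - q) * (1 - q - \<epsilon>)"
      by (simp add: algebra_simps)
    ultimately have "r k \<le> 1 - t - (1 - q) * (1 - q - \<epsilon>)"
      using Nq by simp
    also have "\<dots> \<le> 1 - (q - \<epsilon>) - (1 - q) * (1 - q - \<epsilon>)"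
      using t_lower by simp
    also have "\<dots> = q * (1 - q) + 2 * \<epsilon> - q * \<epsilon>"
      by (simp add: algebra_simps)
    finally show ?thesis
      using q eps mult_nonneg_nonneg[of q \<epsilon>] by linarith
  qed
  \<comment> \<open>Comparing the two estimates of \<open>r k\<close>, the main terms are 2 q (1 -
    q) - q = (N - 2) q^2, because N q^2 = q.\<close>
  have diag_upper: "c k k \<le> q\<^sup>2 + 5 * \<epsilon>" for k
  proof -
    have "(N - 2) * c k k \<le> 2 * (q * (1 - q)) + 4 * \<epsilon> + 2 * ((N - 1) * \<epsilon>) - (q - \<epsilon>)"
      using r_lower'[of k] r_upper[of k] t_lower by argo
    also have "\<dots> = N * q\<^sup>2 - 2 * q\<^sup>2 + (2 * N + 3) * \<epsilon>"
      unfolding Nqq by (simp add: power2_eq_square algebra_simps)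
    \<comment> \<open>This needs 3 N \<ge> 13, so \<open>N\<close> at least 5 suffices.\<close>
    also have "(2 * N + 3) * \<epsilon> \<le> (5 * N - 10) * \<epsilon>"
      using N eps by (intro mult_right_mono) auto
    finally have "(N - 2) * c k k \<le> (N - 2) * (q\<^sup>2 + 5 * \<epsilon>)"
      by (simp add: algebra_simps)
    then show ?thesis
      using N by simp
  qed
  \<comment> \<open>The trace is at least \<open>q - \<epsilon>\<close>, and the other diagonal
    entries are bounded above by \<open>diag_upper\<close>.\<close>
  have diag_lower: "q\<^sup>2 - 5 * (N * \<epsilon>) \<le> c k k" for k
  proof -
    have "(\<Sum>l\<in>-{k}. c l l) \<le> (\<Sum>l\<in>-{k}. q\<^sup>2 + 5 * \<epsilon>)"
      by (intro sum_mono diag_upper)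
    then have "t - c k k \<le> (N - 1) * (q\<^sup>2 + 5 * \<epsilon>)"
      using split[of "\<lambda>l. c l l" k] card_compl[of k] by (simp add: t_def)
    then show ?thesis
      using t_lower Nqq eps by (simp add: algebra_simps)
  qed
  have eps_N: "\<epsilon> \<le> N * \<epsilon>" and eps_NN: "5 * (N * \<epsilon>) \<le> N\<^sup>2 * \<epsilon>"
    using N eps mult_right_mono[of 1 N \<epsilon>] mult_right_mono[of 5 N "N * \<epsilon>"]
    by (auto simp: power2_eq_square mult_ac)
  have off_lower: "q\<^sup>2 - 6 * (N * \<epsilon>) \<le> c k l" if "k \<noteq> l" for k l
    using off_diag[OF that] diag_lower[of k] diag_lower[of l] eps_N by argo
  \<comment> \<open>Row \<open>k\<close> has sum at most \<open>r_upper\<close>, and its other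
    \<open>N - 2\<close> off-diagonal entries are bounded below by \<open>off_lower\<close>.\<close>
  have off_upper: "c k l \<le> q\<^sup>2 + 6 * (N\<^sup>2 * \<epsilon>)" if "k \<noteq> l" for k l
  proof -
    have "(\<Sum>j\<in>-{k} - {l}. q\<^sup>2 - 6 * (N * \<epsilon>)) \<le> (\<Sum>j\<in>-{k} - {l}. c k j)"
      by (intro sum_mono off_lower) auto
    moreover have "real (card (-{k} - {l})) = N - 2"
      using that N card_compl[of k] by (simp add: card_Diff_singleton of_nat_diff)
    moreover have "r k = c k l + (\<Sum>j\<in>-{k} - {l}. c k j)"
      unfolding r_def using that by (subst sum.remove[of _ l]) auto
    ultimately have "c k l \<le> q * (1 - q) + 2 * \<epsilon> - (N - 2) * (q\<^sup>2 - 6 * (N * \<epsilon>))"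
      using r_upper[of k] by simp
    also have "\<dots> = q - N * q\<^sup>2 + q\<^sup>2 + 2 * \<epsilon> + 6 * (N\<^sup>2 * \<epsilon>) - 12 * (N * \<epsilon>)"
      by (simp add: power2_eq_square algebra_simps)
    finally show ?thesis
      using Nqq eps_N eps by linarith
  qed
  have "\<bar>c i j - q\<^sup>2\<bar> \<le> 6 * (N\<^sup>2 * \<epsilon>)"
    using diag_upper[of i] diag_lower[of i] off_lower[of i j] off_upper[of i j] eps eps_N eps_NN
    by (cases "i = j") (simp, linarith)+
  then show ?thesis
    by (simp add: q_def power_divide)
qed

section \<open>Choice of \<delta> and combination of rigidity with the near-uniform case\<close>

theorem theorem4p2:
  fixes n :: real
  defines "n \<equiv> real CARD('n::finite)"
  assumes "n \<ge> 5"
  shows "\<exists>\<delta>::real. \<delta> > 1 / 4 \<and>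
    (\<forall>C \<in> (weight_matrices :: (real ^ 'n ^ 'n) set). \<forall>ustar \<in> l1_unit_sphere.
       complexity_metric (n / (n + 2)) C ustar \<le> ereal (\<delta> * n * (n + 2) / (n - 1)) \<longrightarrow>
       \<not> (\<exists>u. spurious_socp C ustar u))"
proof -
  \<comment> \<open>Chosen so that the rigidity error 6 n^2 \<epsilon> equals 1 / (6 n^2).\<close>
  define \<epsilon> where "\<epsilon> = 1 / (36 * n ^ 4)"
  define \<tau> where "\<tau> = 1 - 1 / n - \<epsilon>"
  \<comment> \<open>With this value the metric bound says that the distance to the degenerate set is
    at least 4 \<tau> / (n + 2). Taking \<epsilon> = 0 would give exactly 1/4, so any positive
    \<epsilon> that keeps \<tau> positive yields a larger constant.\<close>
  define \<delta> where "\<delta> = (n - 1) / (4 * n * \<tau>)"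
  have "1 ^ 4 \<le> n ^ 4"
    using \<open>5 \<le> n\<close> by (intro power_mono) auto
  then have \<epsilon>: "0 < \<epsilon>" "\<epsilon> \<le> 1 / 36"
    using \<open>5 \<le> n\<close> by (auto simp: \<epsilon>_def divide_le_eq)
  have "1 / n \<le> 1 / 5"
    using \<open>5 \<le> n\<close> by (simp add: field_simps)
  then have "0 < \<tau>"
    using \<epsilon> by (simp add: \<tau>_def)
  have "n * \<tau> < n - 1"
    using \<open>5 \<le> n\<close> \<epsilon> by (simp add: \<tau>_def algebra_simps)
  then have "1 / 4 < \<delta>"
    using \<open>5 \<le> n\<close> \<open>0 < \<tau>\<close> by (simp add: \<delta>_def field_simps)
  have X: "\<delta> * n * (n + 2) / (n - 1) = (n + 2) / (4 * \<tau>)"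
    using \<open>5 \<le> n\<close> \<open>0 < \<tau>\<close> by (simp add: \<delta>_def field_simps)
  define \<alpha> where "\<alpha> = n / (n + 2)"
  have \<alpha>: "0 \<le> \<alpha>" "\<alpha> \<le> 1" "(n + 2) * \<alpha> = n" "(n + 2) * (1 - \<alpha>) = 2"
    using \<open>5 \<le> n\<close> by (auto simp: \<alpha>_def field_simps)
  have "\<not> spurious_socp C z u"
    if C: "C \<in> weight_matrices" and z: "z \<in> l1_unit_sphere"
      and metric: "complexity_metric (n / (n + 2)) C z \<le> ereal (\<delta> * n * (n + 2) / (n - 1))"
    for C :: "real ^ 'n ^ 'n" and z u :: "real ^ 'n"
  proof -
    define c where "c = 1 / ((n + 2) / (4 * \<tau>))"
    have c: "(n + 2) * c = 4 * \<tau>"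
      using \<open>5 \<le> n\<close> by (simp add: c_def)
    \<comment> \<open>For \<alpha> = n / (n + 2), multiplying by n + 2 turns the weights \<alpha>
      and 1 - \<alpha> into n and 2; a division by 4 then gives the hypotheses of
      \<open>weights_nearly_uniform\<close>.\<close>
    have scale: "4 * \<tau> \<le> n * x + 2 * y" if "c \<le> \<alpha> * x + (1 - \<alpha>) * y" for x y
    proof -
      have "(n + 2) * c \<le> (n + 2) * (\<alpha> * x + (1 - \<alpha>) * y)"
        using that \<open>5 \<le> n\<close> by (intro mult_left_mono) auto
      then have "4 * \<tau> \<le> ((n + 2) * \<alpha>) * x + ((n + 2) * (1 - \<alpha>)) * y"
        unfolding c distrib_left mult.assoc .
      then show ?thesis
        unfolding \<alpha> .
    qed
    have low: "c \<le> \<alpha> * mat_l1_norm (C - C') + (1 - \<alpha>) * vec_l1_norm (z - z')"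
      if "(C', z') \<in> degenerate_set" for C' z'
      unfolding c_def using metric \<open>5 \<le> n\<close> \<open>0 < \<tau>\<close> \<alpha>(1,2) that
      by (intro complexity_metric_leD) (simp_all only: X \<alpha>_def, simp)
    have isolate: "\<tau> \<le> n * (\<Sum>j\<in>-{k}. C $ k $ j)" for k
      using scale[of "4 * (\<Sum>j\<in>-{k}. C $ k $ j)" 0]
        degenerate_cost_isolate[OF C z \<alpha>(1,2) low, of k] \<open>5 \<le> n\<close>
      by (simp add: n_def mult_ac)
    have bipartite: "\<tau> \<le> 1 - \<bar>z $ k\<bar> - \<bar>z $ l\<bar> + n / 2 * (C $ k $ k + C $ l $ l)"
      if "k \<noteq> l" for k l
      using scale[OF degenerate_cost_bipartite[OF C z \<alpha>(1,2) low that]] by (simp add: algebra_simps)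
    have disconnect: "\<tau> \<le> 1 - \<bar>z $ k\<bar> - \<bar>z $ l\<bar> + n * C $ k $ l" if "k \<noteq> l" for k l
      using scale[OF degenerate_cost_disconnect[OF C z \<alpha>(1,2) low that]] by (simp add: algebra_simps)
    have near: "\<bar>C $ i $ j - 1 / n\<^sup>2\<bar> \<le> 1 / (6 * n\<^sup>2)" for i j
    proof -
      have "\<bar>C $ i $ j - 1 / n\<^sup>2\<bar> \<le> 6 * n\<^sup>2 * \<epsilon>"
        unfolding n_def
      proof (rule weights_nearly_uniform[where c = "\<lambda>i j. C $ i $ j" and a = "\<lambda>i. \<bar>z $ i\<bar>"])
        show "(\<Sum>i\<in>UNIV. \<Sum>j\<in>UNIV. C $ i $ j) = 1" "(\<Sum>i\<in>UNIV. \<bar>z $ i\<bar>) = 1"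
          using C z by (auto simp: weight_matrices_def l1_unit_sphere_def vec_l1_norm_def)
      qed (use \<open>5 \<le> n\<close> \<epsilon> isolate bipartite disconnect in \<open>auto simp: n_def \<tau>_def\<close>)
      also have "6 * n\<^sup>2 * \<epsilon> = 1 / (6 * n\<^sup>2)"
        using \<open>5 \<le> n\<close> by (simp add: \<epsilon>_def power2_eq_square power4_eq_xxxx)
      finally show ?thesis .
    qed
    show ?thesis
    proof (rule no_spurious_socp_if_nearly_uniform)
      show "transpose C = C"
        using C by (simp add: weight_matrices_def)
      show "1 / n\<^sup>2 - 1 / (6 * n\<^sup>2) \<le> C $ i $ j" "C $ i $ j \<le> 1 / n\<^sup>2 + 1 / (6 * n\<^sup>2)" for i j
        using near[of i j] by (auto simp: abs_le_iff)
      \<comment> \<open>After multiplication by n^2 this is 14/6 < 15/6.\<close>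
      show "2 * (1 / n\<^sup>2 + 1 / (6 * n\<^sup>2)) < 3 * (1 / n\<^sup>2 - 1 / (6 * n\<^sup>2))"
        using \<open>5 \<le> n\<close> by (simp add: divide_simps)
    qed
  qed
  then show ?thesis
    using \<open>1 / 4 < \<delta>\<close> by blast
qed

end
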